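(* Let $A$ be a Frobenius algebra over a field $\Bbbk$ with respect to a non-degenerate associative bilinear form $\langle-,-\rangle$, with Nakayama automorphism $\sigma$. An algebra endomorphism $u:A\to A$ is an automorphism of $A$ if and only if its Nakayama Jacobian $\mathrm{jac}_\sigma(u)$ is a unit in $A$.
   Context: $\Bbbk$ is a field; algebras are associative and unital over $\Bbbk$. A Frobenius algebra is a finite-dimensional algebra $A$ endowed with a non-degenerate bilinear form $\langle-,-\rangle:A\times A\to\Bbbk$ that is associative: $\langle ab,c\rangle=\langle a,bc\rangle$ for all $a,b,c\in A$. Its Nakayama automorphism is the unique algebra automorphism $\sigma:A\to A$ such that $\langle a,b\rangle=\langle b,\sigma(a)\rangle$ for all $a,b\in A$. For an algebra endomorphism $u:A\to A$, the Nakayama Jacobian $\mathrm{jac}_\sigma(u)$ is the unique element of $A$ such that $\langle u(a),u(b)\rangle=\langle\mathrm{jac}_\sigma(u)\cdot a,b\rangle$ for all $a,b\in A$. *)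

theory Defs
  imports Complex_Main
begin

text \<open>
  The sort of \<^typ>\<open>'a\<close> is \<open>{ring, monoid_mult}\<close> rather than \<^class>\<open>ring_1\<close> because the
  latter includes \<open>0 \<noteq> 1\<close> and would exclude the zero algebra.
\<close>

locale algebra_over = vector_space scale
  for scale :: "'k::field \<Rightarrow> 'a::{ring,monoid_mult} \<Rightarrow> 'a" +
  assumes scale_mult_left: "scale c a * b = scale c (a * b)"
    and scale_mult_right: "a * scale c b = scale c (a * b)"

definition algebra_endomorphism ::
    "('k::field \<Rightarrow> 'a::{ring,monoid_mult} \<Rightarrow> 'a) \<Rightarrow> ('a \<Rightarrow> 'a) \<Rightarrow> bool" where
  "algebra_endomorphism scale u \<longleftrightarrow>
     Vector_Spaces.linear scale scale u \<and> (\<forall>a b. u (a * b) = u a * u b) \<and> u 1 = 1"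

definition algebra_automorphism ::
    "('k::field \<Rightarrow> 'a::{ring,monoid_mult} \<Rightarrow> 'a) \<Rightarrow> ('a \<Rightarrow> 'a) \<Rightarrow> bool" where
  "algebra_automorphism scale u \<longleftrightarrow> algebra_endomorphism scale u \<and> bij u"

text \<open>Two-sided units; the library's \<open>is_unit\<close> is only available for commutative rings.\<close>

definition two_sided_unit :: "'a::monoid_mult \<Rightarrow> bool" where
  "two_sided_unit a \<longleftrightarrow> (\<exists>b. a * b = 1 \<and> b * a = 1)"

locale frobenius_algebra = algebra_over scale
  for scale :: "'k::field \<Rightarrow> 'a::{ring,monoid_mult} \<Rightarrow> 'a" +
  fixes form :: "'a \<Rightarrow> 'a \<Rightarrow> 'k"
  assumes finite_dimensional: "\<exists>B. finite_dimensional_vector_space scale B"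
    and form_linear_left: "\<And>b. Vector_Spaces.linear scale (*) (\<lambda>a. form a b)"
    and form_linear_right: "\<And>a. Vector_Spaces.linear scale (*) (\<lambda>b. form a b)"
    and form_nondegenerate_left: "(\<And>b. form a b = 0) \<Longrightarrow> a = 0"
    and form_nondegenerate_right: "(\<And>a. form a b = 0) \<Longrightarrow> b = 0"
    and form_assoc: "form (a * b) c = form a (b * c)"

definition nakayama_automorphism ::
    "('k::field \<Rightarrow> 'a::{ring,monoid_mult} \<Rightarrow> 'a) \<Rightarrow> ('a \<Rightarrow> 'a \<Rightarrow> 'k) \<Rightarrow> 'a \<Rightarrow> 'a" where
  "nakayama_automorphism scale form =
     (THE \<sigma>. algebra_automorphism scale \<sigma> \<and> (\<forall>a b. form a b = form b (\<sigma> a)))"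

text \<open>
  The Jacobian depends on the Nakayama automorphism only through the bilinear form, so no
  separate argument for the automorphism is needed.
\<close>

definition nakayama_jacobian ::
    "('a::{ring,monoid_mult} \<Rightarrow> 'a \<Rightarrow> 'k::field) \<Rightarrow> ('a \<Rightarrow> 'a) \<Rightarrow> 'a" where
  "nakayama_jacobian form u = (THE j. \<forall>a b. form (u a) (u b) = form (j * a) b)"

text \<open>Both definite descriptions above are well defined for every Frobenius algebra.\<close>

lemma (in vector_space) functional_represented:
  fixes f :: "'b \<Rightarrow> 'b \<Rightarrow> 'a"
  assumes B: "finite_dimensional_vector_space scale B"
    and l: "\<And>b. Vector_Spaces.linear scale (*) (\<lambda>a. f a b)"
    and r: "\<And>a. Vector_Spaces.linear scale (*) (\<lambda>b. f a b)"
    and nd: "\<And>a. (\<And>b. f a b = 0) \<Longrightarrow> a = 0"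
    and g: "Vector_Spaces.linear scale (*) g"
  shows "\<exists>a. \<forall>b. f a b = g b"
proof -
  interpret fd: finite_dimensional_vector_space scale B by (rule B)
  interpret P: vector_space_pair scale "(*) :: 'a \<Rightarrow> 'a \<Rightarrow> 'a"
    using g by (simp add: Vector_Spaces.linear_def vector_space_pair_def)
  interpret Q: vector_space_pair scale scale by unfold_locales
  define T where "T a = (\<Sum>b\<in>B. scale (f a b) b)" for a
  have f_add: "f (x + y) b = f x b + f y b" and f_scale: "f (scale c x) b = c * f x b" for x y b c
    using P.linear_add[OF l[of b], of x y] P.linear_scale[OF l[of b], of c x] by auto
  have ext: "h = k" if "Vector_Spaces.linear scale (*) h" "Vector_Spaces.linear scale (*) k"
      "\<And>b. b \<in> B \<Longrightarrow> h b = k b" for h k :: "'b \<Rightarrow> 'a"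
    using P.linear_eq_on[OF that(1,2), of _ B] that(3) fd.span_Basis by auto
  have zero: "Vector_Spaces.linear scale (*) (\<lambda>_::'b. 0::'a)"
    by (rule P.linear_zero)
  have T: "Vector_Spaces.linear scale scale T"
    by (unfold_locales)
      (simp_all add: T_def f_add f_scale scale_left_distrib sum.distrib scale_sum_right)
  have "inj T"
    unfolding Q.linear_inj_iff_eq_0[OF T]
  proof (intro allI impI)
    fix a assume "T a = 0"
    then have "f a b = 0" if "b \<in> B" for b
      using independentD[OF fd.independent_Basis fd.finite_Basis subset_refl, of "f a" b] that
      by (simp add: T_def)
    then have "f a = (\<lambda>_. 0)"
      by (intro ext r zero) auto
    then show "a = 0" by (intro nd) simp
  qed
  then have "surj T" by (rule fd.linear_inj_imp_surj[OF T])
  then obtain a where a: "T a = (\<Sum>b\<in>B. scale (g b) b)" by (metis surjD)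
  have "f a b = g b" if "b \<in> B" for b
  proof -
    have "(\<Sum>b\<in>B. scale (f a b - g b) b) = 0"
      using a by (simp add: T_def scale_left_diff_distrib sum_subtractf)
    from independentD[OF fd.independent_Basis fd.finite_Basis subset_refl this that]
    show ?thesis by simp
  qed
  then have "f a = g" by (intro ext r g) auto
  then show ?thesis by auto
qed

context frobenius_algebra
begin

interpretation pk: vector_space_pair scale "(*) :: 'k \<Rightarrow> 'k \<Rightarrow> 'k"
  using form_linear_left by (simp add: Vector_Spaces.linear_def vector_space_pair_def)

interpretation pa: vector_space_pair scale scale
  by unfold_locales

lemma form_simps:
  shows "form (a + b) c = form a c + form b c" "form a (b + c) = form a b + form a c"
    and "form (a - b) c = form a c - form b c" "form a (b - c) = form a b - form a c"
    and "form (scale k a) b = k * form a b" "form a (scale k b) = k * form a b"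
  using pk.linear_add[OF form_linear_left[of c]] pk.linear_add[OF form_linear_right[of a]]
    pk.linear_diff[OF form_linear_left[of c]] pk.linear_diff[OF form_linear_right[of a]]
    pk.linear_scale[OF form_linear_left[of b]] pk.linear_scale[OF form_linear_right[of a]]
  by auto

lemma form_eqI_left: "(\<And>c. form a c = form b c) \<Longrightarrow> a = b"
  using form_nondegenerate_left[of "a - b"] by (simp add: form_simps)

lemma form_eqI_right: "(\<And>c. form c a = form c b) \<Longrightarrow> a = b"
  using form_nondegenerate_right[of "a - b"] by (simp add: form_simps)

lemma ex1_nakayama_automorphism:
  "\<exists>!\<sigma>. algebra_automorphism scale \<sigma> \<and> (\<forall>a b. form a b = form b (\<sigma> a))"
proof -
  obtain B where B: "finite_dimensional_vector_space scale B" using finite_dimensional ..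
  interpret fd: finite_dimensional_vector_space scale B by (rule B)
  have "\<exists>s. \<forall>b. form b s = form a b" for a
    by (rule functional_represented[OF B form_linear_right form_linear_left
          form_nondegenerate_right form_linear_right])
  then obtain \<sigma> where \<sigma>: "\<And>a b. form b (\<sigma> a) = form a b" by metis
  have lin: "Vector_Spaces.linear scale scale \<sigma>"
    by (unfold_locales) (rule form_eqI_right, simp add: \<sigma> form_simps)+
  have mult: "\<sigma> (a * b) = \<sigma> a * \<sigma> b" for a b
  proof (rule form_eqI_right)
    fix c
    have "form c (\<sigma> (a * b)) = form a (b * c)" by (simp add: \<sigma> form_assoc)
    also have "\<dots> = form b (c * \<sigma> a)" using \<sigma>[of "b * c" a] by (simp add: form_assoc)
    also have "\<dots> = form c (\<sigma> a * \<sigma> b)" using \<sigma>[of "c * \<sigma> a" b] by (simp add: form_assoc)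
    finally show "form c (\<sigma> (a * b)) = form c (\<sigma> a * \<sigma> b)" .
  qed
  have one: "\<sigma> 1 = 1"
    by (rule form_eqI_right) (metis \<sigma> form_assoc mult_1_left mult_1_right)
  have "inj \<sigma>"
    by (rule injI) (metis \<sigma> form_eqI_left)
  then have "bij \<sigma>"
    using fd.linear_inj_imp_surj[OF lin] by (simp add: bij_def)
  with lin mult one have "algebra_automorphism scale \<sigma>"
    by (simp add: algebra_automorphism_def algebra_endomorphism_def)
  moreover have "\<tau> = \<sigma>" if "\<forall>a b. form a b = form b (\<tau> a)" for \<tau>
    by (rule ext, rule form_eqI_right) (metis \<sigma> that)
  ultimately show ?thesis using \<sigma> by (intro ex1I[of _ \<sigma>]) auto
qed

lemma ex1_nakayama_jacobian:
  assumes u: "algebra_endomorphism scale u"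
  shows "\<exists>!j. \<forall>a b. form (u a) (u b) = form (j * a) b"
proof -
  obtain B where B: "finite_dimensional_vector_space scale B" using finite_dimensional ..
  have lin: "Vector_Spaces.linear scale scale u" and mult: "\<And>a b. u (a * b) = u a * u b"
    using u by (auto simp: algebra_endomorphism_def)
  have "Vector_Spaces.linear scale (*) (\<lambda>b. form 1 (u b))"
    by (unfold_locales)
      (simp_all add: pa.linear_add[OF lin] pa.linear_scale[OF lin] form_simps)
  from functional_represented[OF B form_linear_left form_linear_right
      form_nondegenerate_left this]
  obtain j where j: "\<And>b. form j b = form 1 (u b)" by auto
  have "form (u a) (u b) = form (j * a) b" for a b
    using form_assoc[of 1 "u a" "u b"] by (simp add: form_assoc[of j] j mult)
  moreover have "k = j" if "\<forall>a b. form (u a) (u b) = form (k * a) b" for k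
    by (rule form_eqI_left) (metis calculation that mult_1_right)
  ultimately show ?thesis by blast
qed

end

end

theory Submission
  imports Defs
begin

text \<open>
  By non-degeneracy, the identity \<open>\<langle>u a, u b\<rangle> = \<langle>jac u \<cdot> a, b\<rangle>\<close> makes \<open>jac u \<cdot> a\<close> depend only
  on \<open>u a\<close>; if \<open>u\<close> is surjective, it also makes \<open>u a\<close> depend only on \<open>jac u \<cdot> a\<close>. Hence \<open>u\<close> is
  injective if left multiplication by \<open>jac u\<close> is, and conversely if \<open>u\<close> is bijective. In finite
  dimension injective linear endomorphisms are bijective, and left multiplication by an element
  is bijective exactly when the element is a unit.
\<close>

lemma two_sided_unit_iff_bij_mult:
  fixes a :: "'a::monoid_mult"
  shows "two_sided_unit a \<longleftrightarrow> bij ((*) a)"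
proof
  assume "two_sided_unit a"
  then obtain b where "a * b = 1" "b * a = 1" by (auto simp: two_sided_unit_def)
  then show "bij ((*) a)"
    by (intro o_bij[of "(*) b"]) (simp_all add: fun_eq_iff flip: mult.assoc)
next
  assume bij_mult: "bij ((*) a)"
  then obtain b where right_inverse: "a * b = 1" by (metis bij_is_surj surjD)
  then have "a * (b * a) = a * 1" by (simp flip: mult.assoc)
  then have "b * a = 1" by (rule injD[OF bij_is_inj[OF bij_mult]])
  with right_inverse show "two_sided_unit a" by (auto simp: two_sided_unit_def)
qed

lemma (in finite_dimensional_vector_space) linear_bij_iff_inj:
  assumes "Vector_Spaces.linear scale scale f"
  shows "bij f \<longleftrightarrow> inj f"
  using linear_inj_imp_surj[OF assms] by (auto simp: bij_def)

lemma (in algebra_over) linear_mult_left: "Vector_Spaces.linear scale scale ((*) a)"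
  by unfold_locales (simp_all add: distrib_left scale_mult_right)

context frobenius_algebra
begin

lemma form_nakayama_jacobian:
  assumes "algebra_endomorphism scale u"
  shows "form (nakayama_jacobian form u * a) b = form (u a) (u b)"
  using theI'[OF ex1_nakayama_jacobian[OF assms]] unfolding nakayama_jacobian_def by metis

lemma nakayama_jacobian_mult_cong:
  assumes "algebra_endomorphism scale u" and "u a = u b"
  shows "nakayama_jacobian form u * a = nakayama_jacobian form u * b"
  using assms by (intro form_eqI_left) (simp add: form_nakayama_jacobian)

lemma nakayama_jacobian_mult_eq_imp_eq:
  assumes u: "algebra_endomorphism scale u" and "surj u"
    and jac_eq: "nakayama_jacobian form u * a = nakayama_jacobian form u * b"
  shows "u a = u b"
proof (rule form_eqI_left)
  fix c
  obtain d where "c = u d" using \<open>surj u\<close> by (rule surjE)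
  then show "form (u a) c = form (u b) c"
    using jac_eq by (simp add: \<open>c = u d\<close> flip: form_nakayama_jacobian[OF u])
qed

lemma bij_iff_bij_nakayama_jacobian_mult:
  assumes u: "algebra_endomorphism scale u"
  shows "bij u \<longleftrightarrow> bij ((*) (nakayama_jacobian form u))"
proof -
  obtain B where "finite_dimensional_vector_space scale B" using finite_dimensional ..
  then interpret finite_dimensional_vector_space scale B .
  have linear_u: "Vector_Spaces.linear scale scale u"
    using u by (simp add: algebra_endomorphism_def)
  show ?thesis
  proof
    assume bij_u: "bij u"
    have "inj ((*) (nakayama_jacobian form u))"
      using nakayama_jacobian_mult_eq_imp_eq[OF u bij_is_surj[OF bij_u]] bij_is_inj[OF bij_u]
      by (intro injI) (rule injD)
    then show "bij ((*) (nakayama_jacobian form u))"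
      by (simp add: linear_bij_iff_inj[OF linear_mult_left])
  next
    assume bij_mult: "bij ((*) (nakayama_jacobian form u))"
    have "inj u"
      using nakayama_jacobian_mult_cong[OF u] bij_is_inj[OF bij_mult]
      by (intro injI) (rule injD)
    then show "bij u" by (simp add: linear_bij_iff_inj[OF linear_u])
  qed
qed

end

theorem proposition3:
  fixes scale :: "'k::field \<Rightarrow> 'a::{ring,monoid_mult} \<Rightarrow> 'a"
    and form :: "'a \<Rightarrow> 'a \<Rightarrow> 'k"
    and \<sigma> u :: "'a \<Rightarrow> 'a"
  assumes "frobenius_algebra scale form"
    and "\<sigma> = nakayama_automorphism scale form"
    and "algebra_endomorphism scale u"
  shows "algebra_automorphism scale u \<longleftrightarrow> two_sided_unit (nakayama_jacobian form u)"
proof -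
  interpret frobenius_algebra scale form by fact
  have "algebra_automorphism scale u \<longleftrightarrow> bij u"
    using assms(3) by (simp add: algebra_automorphism_def)
  also have "\<dots> \<longleftrightarrow> bij ((*) (nakayama_jacobian form u))"
    using assms(3) by (rule bij_iff_bij_nakayama_jacobian_mult)
  also have "\<dots> \<longleftrightarrow> two_sided_unit (nakayama_jacobian form u)"
    by (rule two_sided_unit_iff_bij_mult [symmetric])
  finally show ?thesis .
qed

end
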